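(* Consider a causal model without unobserved nodes over a finite set $S$ of random variables, given by structural equations, with causal structure $\mathcal G$. Then, for every pair of nodes, the existence of a directed path in $\mathcal G$ from the one to the other can be confirmed or excluded using the complete set of irreducible unconditional 0th-order affects relations $X\models Y$ holding in the model (with $X,Y\subseteq S$ disjoint and non-empty) that satisfy $|Y|=1$. (That is: the relation "there is a directed path from $N$ to $M$ in $\mathcal G$" on $S$ is determined by the set of all irreducible affects relations $X\models Y$ with $|Y|=1$ that hold in the model.)
   Context: The causal structure is a directed graph $\mathcal G$ (possibly cyclic) with node set $S$, all nodes being observed (discrete) random variables; $\mathrm{par}(Y)$ is the set of $N\in S$ with an edge $N\to Y$ (no node is its own parent). Directed paths have at least one edge. The model is given by structural equations: each non-exogenous node $Y$ (i.e. with $\mathrm{par}(Y)\ne\emptyset$) is given by a stochastic map (classical channel) $Y=f_Y(\mathrm{par}(Y))$, where no proper subset of $\mathrm{par}(Y)$ suffices as argument of $f_Y$ to give the same probability distribution (so $f_Y$ genuinely depends on each parent; in particular $f_Y$ is not constant). In the cyclic case the structural equations are required to be mutually consistent. Interventions: for $Z\subseteq S$, $\mathcal G_{\mathrm{do}(Z)}$ is obtained by deleting all edges into $Z$ and letting each element of $Z$ be set freely to an arbitrary chosen value by an exogenous intervention variable, keeping the maps $f_Y$ for $Y\notin Z$; the resulting distribution is $P_{\mathcal G_{\mathrm{do}(Z)}}(\cdot\mid Z=z)$. In particular, if $\mathrm{par}(Y)\subseteq Z\not\ni Y$, then under this intervention $Y$ is distributed as $f_Y$ evaluated at the enforced values of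 $\mathrm{par}(Y)$. All distributions are compatible with their graphs via d-separation: d-separation of observed sets (including intervention variables) implies the corresponding conditional independence; in particular intervening on a set does not change the distribution of nodes which are not descendants of it. Affects relations: for pairwise disjoint $X,Y,Z\subseteq S$ with $X,Y$ non-empty, $X\models Y\mid\mathrm{do}(Z)$ holds if there exist values $x,z$ with $P_{\mathcal G_{\mathrm{do}(X\cup Z)}}(Y| X=x,Z=z)\neq P_{\mathcal G_{\mathrm{do}(Z)}}(Y| Z=z)$; $X\models Y$ denotes the case $Z=\emptyset$. $X\models Y$ is irreducible if $s_X\models Y\mid\mathrm{do}(X\setminus s_X)$ for every non-empty $s_X\subsetneq X$. *)

theory Defs
  imports "HOL-Probability.Probability"
begin

section \<open>Directed graphs and d-separation\<close>

text \<open>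
  Between two nodes of a cyclic graph there may be edges in both directions, so a path is a list
  of pairwise distinct nodes together with a choice, for every step, of the edge that is followed:
  \<open>ds ! i\<close> tells whether the \<open>i\<close>-th step follows its edge forwards.
\<close>

definition is_path :: "('m \<times> 'm) set \<Rightarrow> 'm list \<Rightarrow> bool list \<Rightarrow> bool" where
  "is_path E ns ds \<longleftrightarrow>
     length ns = Suc (length ds) \<and> distinct ns \<and>
     (\<forall>i<length ds. if ds ! i then (ns ! i, ns ! Suc i) \<in> E else (ns ! Suc i, ns ! i) \<in> E)"

definition path_blocked :: "('m \<times> 'm) set \<Rightarrow> 'm set \<Rightarrow> 'm list \<Rightarrow> bool list \<Rightarrow> bool" where
  "path_blocked E C ns ds \<longleftrightarrow>
     (\<exists>i. Suc i < length ds \<and>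
        (if ds ! i \<and> \<not> ds ! Suc i
         then \<forall>c\<in>C. (ns ! Suc i, c) \<notin> E\<^sup>*
         else ns ! Suc i \<in> C))"

definition d_separated :: "('m \<times> 'm) set \<Rightarrow> 'm set \<Rightarrow> 'm set \<Rightarrow> 'm set \<Rightarrow> bool" where
  "d_separated E A B C \<longleftrightarrow>
     (\<forall>ns ds. is_path E ns ds \<and> hd ns \<in> A \<and> last ns \<in> B \<longrightarrow> path_blocked E C ns ds)"

text \<open>
  Conditional independence of the coordinates in \<open>A\<close> and those in \<open>B\<close> given those in \<open>C\<close>,
  multiplied out so that conditioning events of probability zero impose nothing.
\<close>

definition agree_event :: "'m set \<Rightarrow> ('m \<Rightarrow> 'u) \<Rightarrow> ('m \<Rightarrow> 'u) set" where
  "agree_event D s = {t. \<forall>d\<in>D. t d = s d}"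

definition cond_indep :: "('m \<Rightarrow> 'u) pmf \<Rightarrow> 'm set \<Rightarrow> 'm set \<Rightarrow> 'm set \<Rightarrow> bool" where
  "cond_indep \<mu> A B C \<longleftrightarrow>
     (\<forall>s. measure_pmf.prob \<mu> (agree_event (A \<union> B \<union> C) s) * measure_pmf.prob \<mu> (agree_event C s) =
          measure_pmf.prob \<mu> (agree_event (A \<union> C) s) * measure_pmf.prob \<mu> (agree_event (B \<union> C) s))"


section \<open>Causal models\<close>

text \<open>
  \<open>dist M Z z\<close> is the joint distribution of all nodes when \<open>Z\<close> is set to \<open>z\<close>; for \<open>Z = {}\<close> it is
  the observed distribution. It is part of the data of the model because in a cyclic graph the
  structural maps \<open>smap M\<close> need not determine it. Assignments of values to a set of nodes are
  extensional functions on that set.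
\<close>

record ('n, 'v) causal_data =
  edges :: "('n \<times> 'n) set"
  vals :: "'n \<Rightarrow> 'v set"
  smap :: "'n \<Rightarrow> ('n \<Rightarrow> 'v) \<Rightarrow> 'v pmf"
  dist :: "'n set \<Rightarrow> ('n \<Rightarrow> 'v) \<Rightarrow> ('n \<Rightarrow> 'v) pmf"

definition par :: "('n, 'v) causal_data \<Rightarrow> 'n \<Rightarrow> 'n set" where
  "par M Y = {N. (N, Y) \<in> edges M}"

definition assignments :: "('n, 'v) causal_data \<Rightarrow> 'n set \<Rightarrow> ('n \<Rightarrow> 'v) set" where
  "assignments M X = PiE X (vals M)"

definition directed_path :: "('n, 'v) causal_data \<Rightarrow> 'n \<Rightarrow> 'n \<Rightarrow> bool" where
  "directed_path M N K \<longleftrightarrow> (N, K) \<in> (edges M)\<^sup>+"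

definition do_edges :: "('n, 'v) causal_data \<Rightarrow> 'n set \<Rightarrow> ('n \<times> 'n) set" where
  "do_edges M Z = {(u, v) \<in> edges M. v \<notin> Z}"

text \<open>
  Interventional graphs with their intervention variables made explicit. The nodes in \<open>Z\<close> are
  always intervened on and lose their incoming edges; the nodes in \<open>W\<close> are intervened on or left
  alone, depending on the value of their intervention variable. An intervention variable takes the
  value \<open>None\<close> if it is idle and \<open>Some v\<close> if it enforces the value \<open>v\<close>.
\<close>

datatype 'n aug_node = Obs 'n | Intv 'n

definition aug_nodes :: "'n set \<Rightarrow> 'n set \<Rightarrow> 'n set \<Rightarrow> 'n aug_node set" where
  "aug_nodes S Z W = Obs ` S \<union> Intv ` (Z \<union> W)"

definition aug_edges ::
  "('n, 'v) causal_data \<Rightarrow> 'n set \<Rightarrow> 'n set \<Rightarrow> ('n aug_node \<times> 'n aug_node) set" where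
  "aug_edges M Z W =
     {(Obs u, Obs v) | u v. (u, v) \<in> do_edges M Z} \<union> {(Intv x, Obs x) | x. x \<in> Z \<union> W}"

definition admissible_settings ::
  "('n, 'v) causal_data \<Rightarrow> 'n set \<Rightarrow> 'n set \<Rightarrow> ('n \<Rightarrow> 'v option pmf) \<Rightarrow> bool" where
  "admissible_settings M Z W q \<longleftrightarrow>
     (\<forall>x\<in>Z. set_pmf (q x) \<subseteq> Some ` vals M x) \<and>
     (\<forall>x\<in>W. set_pmf (q x) \<subseteq> insert None (Some ` vals M x))"

definition aug_dist ::
  "('n, 'v) causal_data \<Rightarrow> 'n set \<Rightarrow> 'n set \<Rightarrow> ('n \<Rightarrow> 'v option pmf)
     \<Rightarrow> ('n aug_node \<Rightarrow> 'v option) pmf" where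
  "aug_dist M Z W q =
     bind_pmf (Pi_pmf (Z \<union> W) None q)
       (\<lambda>i. map_pmf (\<lambda>s a. case a of Obs n \<Rightarrow> Some (s n) | Intv x \<Rightarrow> i x)
              (dist M (dom i) (restrict (the \<circ> i) (dom i))))"

text \<open>
  \<open>smap_minimal\<close>: no proper subset of the parents suffices as argument of a structural map.

  \<open>structural\<close>: in a cyclic graph the conditional law of \<open>Y\<close> given its parents need not be the
  structural map, since the parents of \<open>Y\<close> may in turn depend on \<open>Y\<close>. The conditional law is
  therefore prescribed exactly when \<open>Y\<close> lies on no directed cycle of the intervened graph (so always
  in the acyclic case, and whenever all parents of \<open>Y\<close> are intervened on), whereas
  \<open>structural_support\<close> holds for all nodes; for a deterministic map it says that the structural
  equation is satisfied almost surely. Mutual consistency of the structural equations is the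
  existence of these distributions under every intervention.

  \<open>compatible\<close>: for \<open>W = {}\<close> this concerns the graph in which \<open>Z\<close> is intervened on, for \<open>Z = {}\<close>
  the unmodified graph augmented with intervention variables.
\<close>

locale causal_model =
  fixes S :: "'n set" and M :: "('n, 'v) causal_data"
  assumes finite_nodes: "finite S"
    and edges_subset: "edges M \<subseteq> S \<times> S"
    and no_self_parent: "(n, n) \<notin> edges M"
    and vals_countable: "n \<in> S \<Longrightarrow> countable (vals M n)"
    and smap_vals:
      "\<lbrakk>Y \<in> S; par M Y \<noteq> {}; p \<in> assignments M (par M Y)\<rbrakk> \<Longrightarrow> set_pmf (smap M Y p) \<subseteq> vals M Y"
    and smap_minimal:
      "\<lbrakk>Y \<in> S; par M Y \<noteq> {}; Q \<subset> par M Y\<rbrakk> \<Longrightarrow>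
         \<not> (\<exists>g. \<forall>p\<in>assignments M (par M Y). smap M Y p = g (restrict p Q))"
    and dist_support:
      "\<lbrakk>Z \<subseteq> S; z \<in> assignments M Z; s \<in> set_pmf (dist M Z z)\<rbrakk> \<Longrightarrow>
         s \<in> assignments M S \<and> restrict s Z = z"
    and structural:
      "\<lbrakk>Z \<subseteq> S; z \<in> assignments M Z; Y \<in> S - Z; par M Y \<noteq> {}; (Y, Y) \<notin> (do_edges M Z)\<^sup>+;
        p \<in> assignments M (par M Y)\<rbrakk> \<Longrightarrow>
         measure_pmf.prob (dist M Z z) {s. restrict s (par M Y) = p \<and> s Y = y} =
         measure_pmf.prob (dist M Z z) {s. restrict s (par M Y) = p} * pmf (smap M Y p) y"
    and structural_support:
      "\<lbrakk>Z \<subseteq> S; z \<in> assignments M Z; Y \<in> S - Z; par M Y \<noteq> {}; s \<in> set_pmf (dist M Z z)\<rbrakk> \<Longrightarrow>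
         s Y \<in> set_pmf (smap M Y (restrict s (par M Y)))"
    and compatible:
      "\<lbrakk>Z \<subseteq> S; W \<subseteq> S; Z \<inter> W = {}; admissible_settings M Z W q;
        A \<subseteq> aug_nodes S Z W; B \<subseteq> aug_nodes S Z W; C \<subseteq> aug_nodes S Z W;
        A \<inter> B = {}; A \<inter> C = {}; B \<inter> C = {};
        d_separated (aug_edges M Z W) A B C\<rbrakk> \<Longrightarrow>
         cond_indep (aug_dist M Z W q) A B C"


section \<open>Affects relations\<close>

definition marginal :: "'n set \<Rightarrow> ('n \<Rightarrow> 'v) pmf \<Rightarrow> ('n \<Rightarrow> 'v) pmf" where
  "marginal Y \<mu> = map_pmf (\<lambda>s. restrict s Y) \<mu>"

text \<open>The assignment \<open>w\<close> of \<open>X \<union> Z\<close> combines the values \<open>x\<close> and \<open>z\<close> of \<open>X\<close> and \<open>Z\<close>.\<close>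

definition affects ::
  "'n set \<Rightarrow> ('n, 'v) causal_data \<Rightarrow> 'n set \<Rightarrow> 'n set \<Rightarrow> 'n set \<Rightarrow> bool" where
  "affects S M X Y Z \<longleftrightarrow>
     X \<subseteq> S \<and> Y \<subseteq> S \<and> Z \<subseteq> S \<and> X \<noteq> {} \<and> Y \<noteq> {} \<and>
     X \<inter> Y = {} \<and> X \<inter> Z = {} \<and> Y \<inter> Z = {} \<and>
     (\<exists>w\<in>assignments M (X \<union> Z).
        marginal Y (dist M (X \<union> Z) w) \<noteq> marginal Y (dist M Z (restrict w Z)))"

definition irreducible_affects ::
  "'n set \<Rightarrow> ('n, 'v) causal_data \<Rightarrow> 'n set \<Rightarrow> 'n set \<Rightarrow> bool" where
  "irreducible_affects S M X Y \<longleftrightarrow>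
     affects S M X Y {} \<and> (\<forall>s. s \<noteq> {} \<and> s \<subset> X \<longrightarrow> affects S M s Y (X - s))"

end

theory Submission imports Defs begin

text \<open>
  Let \<open>R\<close> relate \<open>N\<close> to \<open>Y\<close> if \<open>N \<in> X\<close> for some irreducible \<open>X \<Turnstile> {Y}\<close>. Fixing all parents of
  \<open>Y\<close> reproduces its structural map, which depends on every parent, so \<open>par(Y) \<Turnstile> {Y}\<close> is irreducible
  and \<open>R\<close> contains every edge. Conversely, if \<open>X \<Turnstile> {Y}\<close> is irreducible then each \<open>N \<in> X\<close> affects
  \<open>Y\<close> once the rest of \<open>X\<close> is fixed; as the intervention variable of \<open>N\<close> is d-connected to \<open>Y\<close> only
  by a directed path, \<open>N\<close> is an ancestor of \<open>Y\<close>. Hence \<open>R\<close> and the edge relation have the same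
  transitive closure.
\<close>

lemma marginal_singleton_eq_iff:
  "marginal {y} \<mu> = marginal {y} \<nu> \<longleftrightarrow> map_pmf (\<lambda>s. s y) \<mu> = map_pmf (\<lambda>s. s y) \<nu>"
proof
  assume "marginal {y} \<mu> = marginal {y} \<nu>"
  then have "map_pmf (\<lambda>f. f y) (marginal {y} \<mu>) = map_pmf (\<lambda>f. f y) (marginal {y} \<nu>)"
    by simp
  then show "map_pmf (\<lambda>s. s y) \<mu> = map_pmf (\<lambda>s. s y) \<nu>"
    by (simp add: marginal_def pmf.map_comp o_def)
next
  assume "map_pmf (\<lambda>s. s y) \<mu> = map_pmf (\<lambda>s. s y) \<nu>"
  then have "map_pmf (\<lambda>v. restrict (\<lambda>_. v) {y}) (map_pmf (\<lambda>s. s y) \<mu>) =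
             map_pmf (\<lambda>v. restrict (\<lambda>_. v) {y}) (map_pmf (\<lambda>s. s y) \<nu>)"
    by simp
  moreover have "(\<lambda>s::'a \<Rightarrow> 'b. restrict (\<lambda>_. s y) {y}) = (\<lambda>s. restrict s {y})"
    by (auto simp: fun_eq_iff restrict_def)
  ultimately show "marginal {y} \<mu> = marginal {y} \<nu>"
    by (simp add: marginal_def pmf.map_comp o_def)
qed

section \<open>d-separation of an intervention variable from a node\<close>

lemma aug_edges_Obs_rtrancl:
  assumes "(Obs u, b) \<in> (aug_edges M Z W)\<^sup>*" and "b = Obs v"
  shows "(u, v) \<in> (edges M)\<^sup>*"
  using assms
proof (induction arbitrary: v rule: rtrancl_induct)
  case base
  then show ?case by simp
next
  case (step a b)
  then obtain u' where "a = Obs u'" "(u', v) \<in> edges M"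
    by (auto simp: aug_edges_def do_edges_def dest: rtranclD tranclD2 elim: rtranclE)
  with step.IH[of u'] show ?case by (auto intro: rtrancl.rtrancl_into_rtrancl)
qed

text \<open>An intervention variable has a single edge, pointing to its node, so every path from it
  starts forwards. With nothing conditioned on, each collider blocks; an open path therefore never
  turns and would be a directed path from \<open>x\<close> to \<open>y\<close>.\<close>

lemma d_separated_Intv_Obs:
  assumes "x \<noteq> y" and "(x, y) \<notin> (edges M)\<^sup>*"
  shows "d_separated (aug_edges M Z W) {Intv x} {Obs y} {}"
  unfolding d_separated_def
proof (intro allI impI, elim conjE, rule ccontr)
  fix ns ds
  let ?E = "aug_edges M Z W"
  assume path: "is_path ?E ns ds" and hd: "hd ns \<in> {Intv x}" and last: "last ns \<in> {Obs y}"
    and open_path: "\<not> path_blocked ?E {} ns ds"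
  have len: "length ns = Suc (length ds)"
    and step: "\<And>i. i < length ds \<Longrightarrow>
      if ds ! i then (ns ! i, ns ! Suc i) \<in> ?E else (ns ! Suc i, ns ! i) \<in> ?E"
    using path by (auto simp: is_path_def)
  have ns0: "ns ! 0 = Intv x"
    using hd len by (cases ns) auto
  have nsl: "ns ! length ds = Obs y"
    using last len by (metis diff_Suc_1 last_conv_nth list.size(3) nat.distinct(1) singletonD)
  have pos: "0 < length ds"
    using ns0 nsl by (cases "length ds") auto
  have fwd: "ds ! i" if "i < length ds" for i
    using that
  proof (induction i)
    case 0
    show ?case using step[OF 0] ns0 by (auto simp: aug_edges_def split: if_splits)
  next
    case (Suc i)
    then have "ds ! i" by simp
    moreover have "\<not> (ds ! i \<and> \<not> ds ! Suc i)"
      using open_path Suc.prems unfolding path_blocked_def by (metis empty_iff)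
    ultimately show ?case by blast
  qed
  have ns1: "ns ! 1 = Obs x"
    using step[OF pos] fwd[OF pos] ns0 by (auto simp: aug_edges_def)
  have "(ns ! 1, ns ! Suc i) \<in> ?E\<^sup>*" if "i < length ds" for i
    using that
  proof (induction i)
    case (Suc i)
    then show ?case using step[of "Suc i"] fwd[of "Suc i"]
      by (auto intro: rtrancl.rtrancl_into_rtrancl)
  qed simp
  from this[of "length ds - 1"] have "(Obs x, Obs y) \<in> ?E\<^sup>*"
    using pos ns1 nsl by simp
  then show False
    by (rule notE[OF assms(2) aug_edges_Obs_rtrancl[OF _ refl]])
qed

section \<open>From affects relations to directed paths\<close>

text \<open>An affects relation compares two distributions, whereas compatibility concerns one.
  Letting a fair coin decide whether \<open>e\<close> is intervened on mixes both into a single law,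
  with the intervention variable of \<open>e\<close> recording the outcome.\<close>

lemma aug_dist_toggle:
  assumes "finite Z" and "e \<notin> Z" and "w \<in> assignments M (insert e Z)"
  defines "D1 \<equiv> dist M (insert e Z) w" and "D0 \<equiv> dist M Z (restrict w Z)"
  assumes q: "\<And>x. x \<in> Z \<Longrightarrow> q x = return_pmf (Some (w x))"
    and qe: "q e = map_pmf (\<lambda>b. if b then Some (w e) else None) (bernoulli_pmf (1/2))"
  shows "map_pmf (\<lambda>t. (t (Intv e), t (Obs y))) (aug_dist M Z {e} q) =
    bind_pmf (bernoulli_pmf (1/2))
      (\<lambda>b. map_pmf (\<lambda>s. (if b then Some (w e) else None, Some (s y))) (if b then D1 else D0))"
proof -
  \<comment> \<open>The joint setting of the intervention variables after outcome \<open>b\<close>.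
    Its domain is the set of nodes actually intervened on.\<close>
  define i where "i b = (\<lambda>x. if x \<in> Z then Some (w x) else None)
    (e := if b then Some (w e) else None)" for b :: bool
  have "Pi_pmf Z None q = Pi_pmf Z None (\<lambda>x. return_pmf (Some (w x)))"
    by (rule Pi_pmf_cong) (auto simp: q)
  also have "\<dots> = return_pmf (\<lambda>x. if x \<in> Z then Some (w x) else None)"
    by (rule Pi_pmf_return_pmf[OF assms(1)])
  finally have "Pi_pmf (Z \<union> {e}) None q = map_pmf i (bernoulli_pmf (1/2))"
    using assms(1,2)
    by (simp add: Pi_pmf_insert qe pair_pmf_def i_def map_pmf_def bind_assoc_pmf bind_return_pmf)
  moreover have "dom (i True) = insert e Z" "dom (i False) = Z"
    using assms(2) by (auto simp: i_def split: if_splits)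
  moreover have "restrict (the \<circ> i True) (insert e Z) = w"
  proof -
    have "restrict (the \<circ> i True) (insert e Z) = restrict w (insert e Z)"
      by (auto simp: i_def fun_eq_iff restrict_def)
    then show ?thesis using assms(3) by (simp add: assignments_def PiE_restrict)
  qed
  moreover have "restrict (the \<circ> i False) Z = restrict w Z"
    using assms(2) by (auto simp: i_def fun_eq_iff restrict_def)
  ultimately have "aug_dist M Z {e} q = bind_pmf (bernoulli_pmf (1/2))
      (\<lambda>b. map_pmf (\<lambda>s a. case a of Obs n \<Rightarrow> Some (s n) | Intv x \<Rightarrow> i b x) (if b then D1 else D0))"
    unfolding aug_dist_def D1_def D0_def
    by (auto simp: bind_map_pmf intro!: bind_pmf_cong)
  then show ?thesis
    by (simp add: map_bind_pmf pmf.map_comp o_def i_def)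
qed

context causal_model
begin

text \<open>Without a directed path, \<open>Intv e\<close> and \<open>Obs y\<close> are d-separated,
  hence independent under the coin toss. The law of \<open>y\<close> is then the same whether or not
  \<open>e\<close> is intervened on.\<close>

lemma affects_singleton_imp_ancestor:
  assumes "affects S M {e} {y} Z"
  shows "(e, y) \<in> (edges M)\<^sup>+"
proof (rule ccontr)
  assume no_path: "(e, y) \<notin> (edges M)\<^sup>+"
  from assms obtain w where inS: "e \<in> S" "y \<in> S" "Z \<subseteq> S" and disj: "e \<noteq> y" "e \<notin> Z" "y \<notin> Z"
    and w: "w \<in> assignments M (insert e Z)"
    and neq: "marginal {y} (dist M (insert e Z) w) \<noteq> marginal {y} (dist M Z (restrict w Z))"
    by (auto simp: affects_def)
  define D1 where "D1 = dist M (insert e Z) w"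
  define D0 where "D0 = dist M Z (restrict w Z)"
  define q where "q = (\<lambda>x. return_pmf (Some (w x)))
    (e := map_pmf (\<lambda>b. if b then Some (w e) else None) (bernoulli_pmf (1/2)))"
  define \<mu> where "\<mu> = aug_dist M Z {e} q"
  have law: "map_pmf (\<lambda>t. (t (Intv e), t (Obs y))) \<mu> = bind_pmf (bernoulli_pmf (1/2))
      (\<lambda>b. map_pmf (\<lambda>s. (if b then Some (w e) else None, Some (s y))) (if b then D1 else D0))"
    unfolding \<mu>_def D1_def D0_def
    using finite_subset[OF inS(3) finite_nodes] disj w
    by (intro aug_dist_toggle) (auto simp: q_def)
  \<comment> \<open>Stated for an arbitrary \<open>P\<close> so that it yields the joint event and
    both marginal events of the independence equation.\<close>
  have prob: "measure_pmf.prob \<mu> {t. P (t (Intv e)) (t (Obs y))} =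
      (measure_pmf.prob D1 {s. P (Some (w e)) (Some (s y))} +
       measure_pmf.prob D0 {s. P None (Some (s y))}) / 2" for P
  proof -
    have "map_pmf (\<lambda>t. P (t (Intv e)) (t (Obs y))) \<mu> =
        map_pmf (case_prod P) (map_pmf (\<lambda>t. (t (Intv e), t (Obs y))) \<mu>)"
      by (simp add: pmf.map_comp o_def)
    also have "\<dots> = bind_pmf (bernoulli_pmf (1/2))
        (\<lambda>b. map_pmf (\<lambda>s. P (if b then Some (w e) else None) (Some (s y))) (if b then D1 else D0))"
      unfolding law by (simp add: map_bind_pmf pmf.map_comp o_def)
    finally have "pmf (map_pmf (\<lambda>t. P (t (Intv e)) (t (Obs y))) \<mu>) True =
        (pmf (map_pmf (\<lambda>s. P (Some (w e)) (Some (s y))) D1) True +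
         pmf (map_pmf (\<lambda>s. P None (Some (s y))) D0) True) / 2"
      by (simp add: pmf_bind)
    then show ?thesis by (simp add: pmf_map vimage_def)
  qed
  have "admissible_settings M Z {e} q"
    using w disj by (auto simp: admissible_settings_def q_def assignments_def PiE_def Pi_def)
  moreover have "d_separated (aug_edges M Z {e}) {Intv e} {Obs y} {}"
    using no_path disj by (intro d_separated_Intv_Obs) (auto dest: rtranclD)
  ultimately have indep: "cond_indep \<mu> {Intv e} {Obs y} {}"
    unfolding \<mu>_def using inS disj by (intro compatible) (auto simp: aug_nodes_def)
  \<comment> \<open>Write a and b for the two sides. The joint event has probability a/2, its
    marginals 1/2 and (a+b)/2, so independence forces a = b.\<close>
  have "measure_pmf.prob D1 {s. s y = v} = measure_pmf.prob D0 {s. s y = v}" for v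
  proof -
    define s where "s = (\<lambda>_. Some v)(Intv e := Some (w e))"
    have "agree_event ({Intv e} \<union> {Obs y} \<union> {}) s =
        {t. t (Intv e) = Some (w e) \<and> t (Obs y) = Some v}"
      "agree_event ({Intv e} \<union> {}) s = {t. t (Intv e) = Some (w e)}"
      "agree_event ({Obs y} \<union> {}) s = {t. t (Obs y) = Some v}"
      "agree_event {} s = UNIV"
      by (auto simp: agree_event_def s_def)
    moreover note indep[unfolded cond_indep_def, rule_format, of s]
    ultimately show ?thesis
      using prob[of "\<lambda>a b. a = Some (w e) \<and> b = Some v"] prob[of "\<lambda>a b. a = Some (w e)"]
        prob[of "\<lambda>a b. b = Some v"]
      by simp
  qed
  then have "map_pmf (\<lambda>s. s y) D1 = map_pmf (\<lambda>s. s y) D0"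
    by (intro pmf_eqI) (simp add: pmf_map vimage_def)
  with neq show False
    by (simp add: marginal_singleton_eq_iff D1_def D0_def)
qed

text \<open>Irreducibility applies to \<open>{e}\<close> only as a proper subset; for
  \<open>X = {e}\<close> the unconditional relation takes its place.\<close>

lemma irreducible_affects_imp_ancestor:
  assumes "irreducible_affects S M X {y}" and "e \<in> X"
  shows "(e, y) \<in> (edges M)\<^sup>+"
proof (rule affects_singleton_imp_ancestor)
  show "affects S M {e} {y} (X - {e})"
    using assms by (cases "X = {e}") (auto simp: irreducible_affects_def)
qed

section \<open>From edges to irreducible affects relations\<close>

text \<open>Enforcing all parents takes \<open>Y\<close> off every directed cycle, so
  \<open>structural\<close> applies even if the graph is cyclic. Its conditional law is the plain
  law of \<open>Y\<close>, since the parents equal \<open>p\<close> almost surely.\<close>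

lemma dist_do_par:
  assumes "Y \<in> S" and "par M Y \<noteq> {}" and p: "p \<in> assignments M (par M Y)"
  shows "map_pmf (\<lambda>s. s Y) (dist M (par M Y) p) = smap M Y p"
proof (rule pmf_eqI)
  fix v
  let ?P = "par M Y"
  have P: "?P \<subseteq> S" "Y \<notin> ?P"
    using edges_subset no_self_parent by (auto simp: par_def)
  have ac: "(Y, Y) \<notin> (do_edges M ?P)\<^sup>+"
  proof
    assume "(Y, Y) \<in> (do_edges M ?P)\<^sup>+"
    \<comment> \<open>The last edge of the cycle leaves a parent \<open>u\<close>, which differs
      from \<open>Y\<close> and has lost its incoming edges, so \<open>Y\<close> cannot reach
      it.\<close>
    then obtain u where u: "(Y, u) \<in> (do_edges M ?P)\<^sup>*" "(u, Y) \<in> do_edges M ?P"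
      by (meson tranclD2)
    then have "u \<in> ?P" by (auto simp: do_edges_def par_def)
    with u(1) P(2) show False by (auto simp: do_edges_def elim: rtranclE)
  qed
  have supp: "restrict s ?P = p" if "s \<in> set_pmf (dist M ?P p)" for s
    using dist_support[OF P(1) p that] by simp
  have "measure_pmf.prob (dist M ?P p) {s. restrict s ?P = p} = 1"
    using supp by (auto simp: measure_pmf.prob_eq_1 AE_measure_pmf_iff)
  moreover have "measure_pmf.prob (dist M ?P p) {s. restrict s ?P = p \<and> s Y = v} =
      measure_pmf.prob (dist M ?P p) {s. s Y = v}"
    by (rule measure_pmf.finite_measure_eq_AE) (auto simp: AE_measure_pmf_iff supp)
  ultimately show "pmf (map_pmf (\<lambda>s. s Y) (dist M ?P p)) v = pmf (smap M Y p) v"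
    using structural[OF P(1) p _ assms(2) ac p, of v] assms(1) P(2)
    by (simp add: pmf_map vimage_def)
qed

lemma subset_par_affects:
  assumes "Y \<in> S" and "s \<noteq> {}" and "s \<subseteq> par M Y"
  shows "affects S M s {Y} (par M Y - s)"
proof -
  let ?P = "par M Y"
  have P: "?P \<subseteq> S" "Y \<notin> ?P" "?P \<noteq> {}"
    using edges_subset no_self_parent assms by (auto simp: par_def)
  define A where "A = assignments M ?P"
  have "?P - s \<subset> ?P" using assms by auto
  have "\<exists>p\<in>A. \<exists>p'\<in>A. restrict p (?P - s) = restrict p' (?P - s) \<and> smap M Y p \<noteq> smap M Y p'"
  proof (rule ccontr)
    assume *: "\<not> ?thesis"
    have eq: "smap M Y p = smap M Y p'"
      if "p \<in> A" "p' \<in> A" "restrict p (?P - s) = restrict p' (?P - s)" for p p'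
    proof (rule ccontr)
      assume "smap M Y p \<noteq> smap M Y p'"
      from * show False
        by (rule notE) (intro bexI conjI; fact)
    qed
    \<comment> \<open>If \<open>smap M Y\<close> ignored the values on \<open>s\<close>, it would
      factor through the restriction to \<open>?P - s\<close>: \<open>g\<close> evaluates it at any
      assignment extending \<open>r\<close>. This contradicts \<open>smap_minimal\<close>.\<close>
    define g where
      "g r = smap M Y (SOME p. p \<in> A \<and> restrict p (?P - s) = r)" for r
    have "smap M Y p = g (restrict p (?P - s))" if "p \<in> A" for p
    proof -
      define p' where "p' = (SOME p'. p' \<in> A \<and> restrict p' (?P - s) = restrict p (?P - s))"
      have p': "p' \<in> A \<and> restrict p' (?P - s) = restrict p (?P - s)"
        unfolding p'_def by (rule someI[of _ p]) (simp add: that)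
      have "smap M Y p = smap M Y p'"
        by (rule eq) (use that p' in simp_all)
      then show ?thesis unfolding g_def p'_def .
    qed
    then have "\<exists>g. \<forall>p\<in>assignments M ?P. smap M Y p = g (restrict p (?P - s))"
      unfolding A_def by (intro exI[of _ g] ballI)
    with smap_minimal[OF assms(1) P(3) \<open>?P - s \<subset> ?P\<close>] show False
      by (rule notE)
  qed
  then obtain p p' where p: "p \<in> A" "p' \<in> A"
    and same: "restrict p (?P - s) = restrict p' (?P - s)"
    and diff: "smap M Y p \<noteq> smap M Y p'"
    by blast
  have "marginal {Y} (dist M ?P p) \<noteq> marginal {Y} (dist M ?P p')"
    using diff p dist_do_par[OF assms(1) P(3)]
    by (simp add: marginal_singleton_eq_iff A_def)
  \<comment> \<open>As \<open>p\<close> and \<open>p'\<close> agree on \<open>?P - s\<close>, both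
    are compared with the same distribution. Their own marginals differ, so at least one of them
    differs from it.\<close>
  then obtain w where "w \<in> A"
    "marginal {Y} (dist M ?P w) \<noteq> marginal {Y} (dist M (?P - s) (restrict w (?P - s)))"
    using p by (cases "marginal {Y} (dist M ?P p) =
        marginal {Y} (dist M (?P - s) (restrict p (?P - s)))") (auto simp: same)
  moreover have "s \<union> (?P - s) = ?P" using assms by auto
  ultimately show ?thesis
    using assms P by (auto simp: affects_def A_def)
qed

lemma par_irreducible_affects:
  assumes "Y \<in> S" and "par M Y \<noteq> {}"
  shows "irreducible_affects S M (par M Y) {Y}"
  unfolding irreducible_affects_def
proof (intro conjI allI impI)
  show "affects S M (par M Y) {Y} {}"
    using subset_par_affects[OF assms order_refl] by simp
  show "affects S M s {Y} (par M Y - s)" if "s \<noteq> {} \<and> s \<subset> par M Y" for s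
    using subset_par_affects[OF assms(1), of s] that by blast
qed

text \<open>\<open>?R\<close> lies between the edge relation and its transitive closure. It refers
  to the model only through irreducible relations with a singleton target.\<close>

lemma trancl_irreducible_affects:
  "{(N, Y). \<exists>X. N \<in> X \<and> irreducible_affects S M X {Y}}\<^sup>+ = (edges M)\<^sup>+" (is "?R\<^sup>+ = _")
proof
  have "?R \<subseteq> (edges M)\<^sup>+"
    using irreducible_affects_imp_ancestor by blast
  then show "?R\<^sup>+ \<subseteq> (edges M)\<^sup>+"
    using trancl_mono_subset[of ?R "(edges M)\<^sup>+"] by simp
  have "(N, Y) \<in> ?R" if "(N, Y) \<in> edges M" for N Y
  proof -
    have "N \<in> par M Y" "Y \<in> S" using that edges_subset by (auto simp: par_def)
    then show ?thesis using par_irreducible_affects by blast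
  qed
  then show "(edges M)\<^sup>+ \<subseteq> ?R\<^sup>+"
    by (intro trancl_mono_subset) auto
qed

end

theorem lemma3p7:
  fixes S :: "'n set"
    and M :: "('n, 'v) causal_data"
    and M' :: "('n, 'w) causal_data"
  assumes "causal_model S M"
    and "causal_model S M'"
    and "{(X, Y). irreducible_affects S M X Y \<and> card Y = 1} =
         {(X, Y). irreducible_affects S M' X Y \<and> card Y = 1}"
  shows "\<forall>N\<in>S. \<forall>K\<in>S. directed_path M N K \<longleftrightarrow> directed_path M' N K"
proof -
  have "irreducible_affects S M X {Y} \<longleftrightarrow> irreducible_affects S M' X {Y}" for X Y
  proof -
    have "(X, {Y}) \<in> {(X, Y). irreducible_affects S M X Y \<and> card Y = 1} \<longleftrightarrow>
          (X, {Y}) \<in> {(X, Y). irreducible_affects S M' X Y \<and> card Y = 1}"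
      by (simp only: assms(3))
    then show ?thesis by simp
  qed
  then have "(edges M)\<^sup>+ = (edges M')\<^sup>+"
    using causal_model.trancl_irreducible_affects[OF assms(1)]
      causal_model.trancl_irreducible_affects[OF assms(2)] by simp
  then show ?thesis by (simp add: directed_path_def)
qed

end
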